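(* Let $D_1,\dots,D_6$ be the six digraphs on subsets of $\{v_1,\dots,v_7\}$ specified in the context, and let $D\in\{D_1,D_2,D_3,D_4,D_5,D_6\}$. Then: (i) $D$ is a simple directed graph; (ii) $D$ is a directed acyclic graph; (iii) $D$ is weakly connected.
   Context: An arc $(u,v)$ goes from $u$ to $v$. Put $A_1=\{(v_2,v_1),(v_2,v_3),(v_4,v_1),(v_4,v_3)\}$. The digraphs are: - $D_1$: vertices $v_1,v_2,v_3,v_4$; arcs $A_1$. - $D_2$: vertices $v_1,v_2,v_3,v_4,v_6$; arcs $A_1\cup\{(v_6,v_1),(v_6,v_2),(v_6,v_3)\}$. - $D_3$: vertices $v_1,\dots,v_5$; arcs $A_1\cup\{(v_5,v_2),(v_5,v_3),(v_5,v_4)\}$. - $D_4$: vertices $v_1,\dots,v_6$; arcs $A_1\cup\{(v_5,v_2),(v_5,v_3),(v_5,v_4),(v_6,v_1),(v_6,v_2),(v_6,v_3)\}$. - $D_5$: vertices $v_1,\dots,v_7$; the arcs of $D_4$ together with $(v_7,v_5),(v_7,v_6)$. - $D_6$: vertices $v_1,\dots,v_7$; the arcs of $D_5$ together with $(v_5,v_1),(v_6,v_4)$. (The vertices $v_1,\dots,v_7$ represent holomorphic, CR, anti-invariant, slant, semi-slant, hemi-slant and bi-slant submanifolds of almost Hermitian manifolds, but this plays no role in the statement.) Definitions: a simple directed graph is a digraph with no loops and no multiple arcs. A digraph is acyclic if it contains no directed cycle. A digraph is strongly connected if every pair of vertices is mutually reachable by directed paths. A digraph is weakly connected if it is not strongly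 connected but its underlying undirected graph (obtained by replacing each arc by an undirected edge) is connected. *)

theory Defs
  imports "Graph_Theory.Digraph_Component"
begin

datatype vertex = v1 | v2 | v3 | v4 | v5 | v6 | v7

definition A1 :: "(vertex \<times> vertex) set" where
  "A1 = {(v2,v1), (v2,v3), (v4,v1), (v4,v3)}"

text \<open>An arc is its pair (tail, head), as in the set notation for arcs.\<close>

definition D1 :: "(vertex, vertex \<times> vertex) pre_digraph" where
  "D1 = with_proj \<lparr> pverts = {v1,v2,v3,v4}, parcs = A1 \<rparr>"

definition D2 :: "(vertex, vertex \<times> vertex) pre_digraph" where
  "D2 = with_proj \<lparr> pverts = {v1,v2,v3,v4,v6},
                    parcs = A1 \<union> {(v6,v1), (v6,v2), (v6,v3)} \<rparr>"

definition D3 :: "(vertex, vertex \<times> vertex) pre_digraph" where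
  "D3 = with_proj \<lparr> pverts = {v1,v2,v3,v4,v5},
                    parcs = A1 \<union> {(v5,v2), (v5,v3), (v5,v4)} \<rparr>"

definition D4 :: "(vertex, vertex \<times> vertex) pre_digraph" where
  "D4 = with_proj \<lparr> pverts = {v1,v2,v3,v4,v5,v6},
                    parcs = A1 \<union> {(v5,v2), (v5,v3), (v5,v4), (v6,v1), (v6,v2), (v6,v3)} \<rparr>"

definition D5 :: "(vertex, vertex \<times> vertex) pre_digraph" where
  "D5 = with_proj \<lparr> pverts = {v1,v2,v3,v4,v5,v6,v7},
                    parcs = arcs D4 \<union> {(v7,v5), (v7,v6)} \<rparr>"

definition D6 :: "(vertex, vertex \<times> vertex) pre_digraph" where
  "D6 = with_proj \<lparr> pverts = {v1,v2,v3,v4,v5,v6,v7},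
                    parcs = arcs D5 \<union> {(v5,v1), (v6,v4)} \<rparr>"

text \<open>The cycles of the library are directed, and include loops and 2-cycles.\<close>

definition acyclic_digraph :: "('a, 'b) pre_digraph \<Rightarrow> bool" where
  "acyclic_digraph G \<longleftrightarrow> \<not> (\<exists>p. pre_digraph.cycle G p)"

text \<open>
  Weak connectivity here excludes strong connectivity; \<^const>\<open>connected\<close> is
  connectivity of the underlying undirected graph.
\<close>

definition weakly_connected :: "('a, 'b) pre_digraph \<Rightarrow> bool" where
  "weakly_connected G \<longleftrightarrow> \<not> strongly_connected G \<and> connected G"

end

(* Every arc strictly decreases the rank v1, v3 -> 0; v2, v4 -> 1; v5, v6 -> 2; v7 -> 3, so no
   vertex reaches itself by a nonempty walk: this excludes cycles, and, because there is an arc,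
   strong connectivity. For connectedness, a vertex set that contains v2 and is not separated
   from its complement by any arc is seen to contain all vertices. *)

theory Submission
  imports Defs
begin

context wf_digraph
begin

lemma rank_decreasing_reachable1:
  fixes f :: "'a \<Rightarrow> nat"
  assumes "\<And>e. e \<in> arcs G \<Longrightarrow> f (head G e) < f (tail G e)" and "u \<rightarrow>\<^sup>+ v"
  shows "f v < f u"
  using assms(2) by (induction rule: trancl_induct) (auto dest!: assms(1) simp: arcs_ends_conv)

lemma acyclic_digraphI_rank:
  fixes f :: "'a \<Rightarrow> nat"
  assumes "\<And>e. e \<in> arcs G \<Longrightarrow> f (head G e) < f (tail G e)"
  shows "acyclic_digraph G"
  unfolding acyclic_digraph_def cycle_def
  using rank_decreasing_reachable1[of f, OF assms] reachable1_awalkI by blast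

text \<open>An arc and a walk back from its head to its tail would close up to a nonempty walk. Some
  arc must exist: a single vertex without arcs is strongly connected.\<close>

lemma not_strongly_connectedI_rank:
  fixes f :: "'a \<Rightarrow> nat"
  assumes "\<And>e. e \<in> arcs G \<Longrightarrow> f (head G e) < f (tail G e)" and "arcs G \<noteq> {}"
  shows "\<not> strongly_connected G"
proof
  assume sc: "strongly_connected G"
  obtain e where e: "e \<in> arcs G"
    using assms(2) by blast
  have "tail G e \<rightarrow>\<^sup>+ head G e"
    using e by (auto intro: in_arcs_imp_in_arcs_ends)
  also have "head G e \<rightarrow>\<^sup>* tail G e"
    using sc e by (auto simp: strongly_connected_def)
  finally show False
    using rank_decreasing_reachable1[of f, OF assms(1)] by blast
qed

text \<open>Quantifying over \<open>S\<close> replaces the search for walks in a concrete graph by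
  propositional reasoning about membership in \<open>S\<close>.\<close>

lemma connectedI_no_cut:
  assumes "h \<in> verts G"
    and no_cut: "\<And>S. h \<in> S \<Longrightarrow> \<forall>e \<in> arcs G. tail G e \<in> S \<longleftrightarrow> head G e \<in> S \<Longrightarrow> verts G \<subseteq> S"
  shows "connected G"
proof -
  interpret S: pair_wf_digraph "mk_symmetric G" ..
  \<comment> \<open>The component of \<open>h\<close> in the underlying undirected graph; no arc
    leaves or enters it.\<close>
  let ?S = "{v. h \<rightarrow>\<^sup>*\<^bsub>mk_symmetric G\<^esub> v}"
  have "verts G \<subseteq> ?S"
  proof (rule no_cut)
    show "h \<in> ?S"
      using assms(1) by simp
    show "\<forall>e \<in> arcs G. tail G e \<in> ?S \<longleftrightarrow> head G e \<in> ?S"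
    proof
      fix e assume "e \<in> arcs G"
      then have "tail G e \<rightarrow>\<^bsub>mk_symmetric G\<^esub> head G e" "head G e \<rightarrow>\<^bsub>mk_symmetric G\<^esub> tail G e"
        by (auto simp: parcs_mk_symmetric)
      then show "tail G e \<in> ?S \<longleftrightarrow> head G e \<in> ?S"
        by (auto intro: S.reachable_adj_trans)
    qed
  qed
  \<comment> \<open>Walks can be reversed, so any two vertices are joined through
    \<open>h\<close>.\<close>
  moreover have "v \<rightarrow>\<^sup>*\<^bsub>mk_symmetric G\<^esub> h" if "h \<rightarrow>\<^sup>*\<^bsub>mk_symmetric G\<^esub> v" for v
    using symmetric_mk_symmetric that by (rule symmetric_reachable)
  ultimately have "u \<rightarrow>\<^sup>*\<^bsub>mk_symmetric G\<^esub> v" if "u \<in> verts G" "v \<in> verts G" for u v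
    using that by (blast intro: S.reachable_trans)
  then show ?thesis
    using assms(1) by (auto simp: connected_def strongly_connected_def)
qed

end

text \<open>The length of a longest directed path in \<open>D6\<close> from the vertex. The arcs of
  \<open>D6\<close> include those of the other five digraphs, so one rank serves all six.\<close>

fun rank :: "vertex \<Rightarrow> nat" where
  "rank v1 = 0"
| "rank v2 = 1"
| "rank v3 = 0"
| "rank v4 = 1"
| "rank v5 = 2"
| "rank v6 = 2"
| "rank v7 = 3"

theorem theorem3p7:
  fixes D :: "(vertex, vertex \<times> vertex) pre_digraph"
  assumes "D \<in> {D1, D2, D3, D4, D5, D6}"
  shows "digraph D \<and> acyclic_digraph D \<and> weakly_connected D"
proof -
  note defs = D1_def D2_def D3_def D4_def D5_def D6_def A1_def
  have digraph: "digraph D"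
    \<comment> \<open>Arcs are their own end pairs, so parallel arcs coincide.\<close>
    using assms by (elim insertE emptyE; unfold_locales) (auto simp: defs arc_to_ends_def)
  then interpret digraph D .
  have rank: "rank (head D e) < rank (tail D e)" if "e \<in> arcs D" for e
    using assms that by (auto simp: defs)
  have "arcs D \<noteq> {}"
    using assms by (auto simp: defs)
  moreover have "connected D"
  proof (rule connectedI_no_cut)
    show "v2 \<in> verts D"
      using assms by (auto simp: defs)
    show "verts D \<subseteq> S" if "v2 \<in> S" "\<forall>e \<in> arcs D. tail D e \<in> S \<longleftrightarrow> head D e \<in> S" for S
      \<comment> \<open>Membership spreads from \<open>v2\<close> to \<open>v1\<close> and
        \<open>v3\<close>, from there back to \<open>v4\<close>, and then to the remaining
        vertices.\<close>
      using assms that by (elim insertE emptyE) (simp_all add: defs)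
  qed
  ultimately show ?thesis
    using digraph acyclic_digraphI_rank[of rank, OF rank] not_strongly_connectedI_rank[of rank, OF rank]
    by (simp add: weakly_connected_def)
qed

end
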